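(* Let $V$, $M$, $O$ be real Hilbert spaces, let $b : V \times M \to \mathbb{R}$ be a continuous bilinear form, let $B : V \to M$ be defined by $(Bu, \lambda)_M = b(u,\lambda)$ for all $(u,\lambda) \in V \times M$, and let $C : V \to O$ be a continuous linear operator. Assume that $A : V \to M \times O$, $Au = (Bu, Cu)$, is injective. Let $\delta > 0$ and $f^\delta \in O$. Let $(\lambda_\perp^\delta, f_\perp^\delta) \in M \times O$ be the orthogonal projection of $(0, f^\delta) \in M \times O$ on $(\mathrm{Range}\, A)^\perp$ and assume that $$\|\lambda_\perp^\delta\|_M^2 + \|f_\perp^\delta\|_O^2 < \delta^2 < \|f^\delta\|_O^2.$$ For $\varepsilon > 0$, let $(u_\varepsilon^\delta, \lambda_\varepsilon^\delta) \in V \times M$ be the unique solution of $$\begin{cases} \varepsilon (u_\varepsilon^\delta, v)_V + (C u_\varepsilon^\delta, C v)_O + b(v, \lambda_\varepsilon^\delta) = (f^\delta, Cv)_O, \\ b(u_\varepsilon^\delta, \mu) - (\lambda_\varepsilon^\delta, \mu)_M = 0, \end{cases} \quad \forall (v,\mu) \in V \times M.$$ Then there exists a unique $\varepsilon > 0$ such that $$\|\lambda_\varepsilon^\delta\|_M^2 + \|C u_\varepsilon^\delta - f^\delta\|_O^2 = \delta^2.$$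
   Context: $M \times O$ is equipped with the scalar product $((\lambda,f),(\mu,h)) \mapsto (\lambda,\mu)_M + (f,h)_O$, and $(\mathrm{Range}\, A)^\perp$ is the orthogonal complement of $\mathrm{Range}\, A$ for this scalar product. *)

theory Defs
  imports "HOL-Analysis.Analysis"
begin

text \<open>Hilbert spaces are rendered by the sort \<open>{real_inner, complete_space}\<close>. The library instance
  of \<open>real_inner\<close> on \<open>'m \<times> 'o\<close> is the scalar product
  \<open>((\<lambda>, f), (\<mu>, h)) \<mapsto> (\<lambda>, \<mu>) + (f, h)\<close>, so \<open>orthogonal\<close> and \<open>orthogonal_comp\<close> on pairs refer to it.\<close>

text \<open>The vector \<open>B u\<close> is the one given by Riesz representation of the bounded functional \<open>b u\<close>;
  it exists uniquely when \<open>b\<close> is bounded bilinear and \<open>'m\<close> is complete.\<close>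

definition form_operator ::
    "('v \<Rightarrow> 'm \<Rightarrow> real) \<Rightarrow> 'v \<Rightarrow> 'm::{real_inner, complete_space}" where
  "form_operator b u = (THE w. \<forall>\<mu>. w \<bullet> \<mu> = b u \<mu>)"

text \<open>For a closed subspace \<open>S\<close> of a Hilbert space the projection exists uniquely. It is applied below
  only to orthogonal complements, which are always closed.\<close>

definition orthogonal_projection ::
    "'a set \<Rightarrow> 'a \<Rightarrow> 'a::{real_inner, complete_space}" where
  "orthogonal_projection S x = (THE p. p \<in> S \<and> (\<forall>y\<in>S. orthogonal (x - p) y))"

definition solves_mixed ::
    "('v \<Rightarrow> 'm \<Rightarrow> real) \<Rightarrow> ('v \<Rightarrow> 'o) \<Rightarrow> 'o::{real_inner, complete_space} \<Rightarrow> real \<Rightarrow>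
      'v::{real_inner, complete_space} \<times> 'm::{real_inner, complete_space} \<Rightarrow> bool" where
  "solves_mixed b C f \<epsilon> = (\<lambda>(u, l). \<forall>v \<mu>.
      \<epsilon> * (u \<bullet> v) + C u \<bullet> C v + b v l = f \<bullet> C v \<and>
      b u \<mu> - l \<bullet> \<mu> = 0)"

text \<open>For bounded linear \<open>C\<close>, bounded bilinear \<open>b\<close> and \<open>\<epsilon> > 0\<close> the mixed problem has exactly one
  solution.\<close>

definition mixed_solution ::
    "('v \<Rightarrow> 'm \<Rightarrow> real) \<Rightarrow> ('v \<Rightarrow> 'o) \<Rightarrow> 'o::{real_inner, complete_space} \<Rightarrow> real \<Rightarrow>
      'v::{real_inner, complete_space} \<times> 'm::{real_inner, complete_space}" where
  "mixed_solution b C f \<epsilon> = (THE p. solves_mixed b C f \<epsilon> p)"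

end

theory Submission
  imports Defs
begin

text \<open>
  With \<open>g = (0, f)\<close>, the second equation of the mixed problem says \<open>l = B u\<close>, so the first one is the
  normal equation \<open>\<epsilon> (u, v) + (A u, A v) = (g, A v)\<close> of Tikhonov regularization for \<open>A u = g\<close>, and
  the quantity to be matched with \<open>\<delta>\<^sup>2\<close> is the squared residual \<open>\<parallel>g - A u\<^sub>\<epsilon>\<parallel>\<^sup>2\<close>. The claim is
  Morozov's discrepancy principle: this squared residual is continuous and strictly increasing in
  \<open>\<epsilon>\<close>, it tends to \<open>\<parallel>g\<parallel>\<^sup>2 = \<parallel>f\<parallel>\<^sup>2\<close> at infinity and to the squared norm of the projection of \<open>g\<close> on
  the orthogonal complement of the range of \<open>A\<close> at zero, so it takes each value in between exactly
  once.

  All of this follows from subtracting the normal equations for two parameters \<open>\<epsilon> < \<eta>\<close>. With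
  \<open>d = u\<^sub>\<epsilon> - u\<^sub>\<eta>\<close> this gives \<open>\<eta> \<parallel>d\<parallel>\<^sup>2 + \<parallel>A d\<parallel>\<^sup>2 = (\<eta> - \<epsilon>) (u\<^sub>\<epsilon>, d)\<close>, which yields continuity at once.
  Since the residuals \<open>r\<close> satisfy \<open>(r\<^sub>\<epsilon>, A v) = \<epsilon> (u\<^sub>\<epsilon>, v)\<close>, it also yields
  \<open>\<parallel>r\<^sub>\<eta>\<parallel>\<^sup>2 = \<parallel>r\<^sub>\<epsilon>\<parallel>\<^sup>2 + \<parallel>r\<^sub>\<eta> - r\<^sub>\<epsilon>\<parallel>\<^sup>2 + 2 \<epsilon> (u\<^sub>\<epsilon>, d)\<close> with \<open>(u\<^sub>\<epsilon>, d) \<ge> 0\<close>, which is monotonicity. The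
  same inequality bounds \<open>\<parallel>r\<^sub>\<eta> - r\<^sub>\<epsilon>\<parallel>\<^sup>2\<close> by the increment of a bounded monotone function, so the
  residuals converge as \<open>\<epsilon>\<close> tends to zero; the limit is orthogonal to the range of \<open>A\<close> and differs
  from \<open>g\<close> by a limit of elements of the range, so it is the projection. This same convergence
  shows that the projection exists. The monotonicity is strict because \<open>d = 0\<close> would force
  \<open>u\<^sub>\<epsilon> = 0\<close> and \<open>g\<close> orthogonal to the range of \<open>A\<close>; then every residual would be \<open>g\<close>, and its norm
  could not drop below \<open>\<delta>\<close>. The lemmas are \<open>parameter_change\<close>, \<open>residual_increment\<close>,
  \<open>residual_strict_mono\<close>, \<open>residual_tendsto_data\<close> and \<open>residual_tendsto_orthogonal_projection\<close>.

  Existence of \<open>B\<close> and of the solutions of the mixed problem both come from minimizing a coercive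
  quadratic functional on a Hilbert space (\<open>symmetric_lax_milgram\<close>).
\<close>

section \<open>Minimization of coercive quadratic functionals\<close>

text \<open>The solution is the minimizer of the energy \<open>a v v - 2 L v\<close>. By the parallelogram identity the
  energy controls distances between near-minimizers, so minimizing sequences are Cauchy. The case
  where \<open>a\<close> is the inner product is the Riesz representation theorem.\<close>

lemma symmetric_lax_milgram:
  fixes a :: "'v::{real_inner, complete_space} \<Rightarrow> 'v \<Rightarrow> real"
  assumes a: "bounded_bilinear a" and sym: "\<And>x y. a x y = a y x"
    and \<alpha>: "\<alpha> > 0" and coercive: "\<And>x. \<alpha> * (norm x)\<^sup>2 \<le> a x x"
    and L: "bounded_linear L"
  shows "\<exists>x. \<forall>v. a x v = L v"
proof -
  interpret a: bounded_bilinear a by (fact a)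
  interpret L: bounded_linear L by (fact L)
  define J where "J v = a v v - 2 * L v" for v
  obtain K where K: "\<And>x. norm (L x) \<le> norm x * K" using L.bounded by blast
  have lower: "- K\<^sup>2 / \<alpha> \<le> J v" for v
  proof -
    have "0 \<le> (\<alpha> * norm v - K)\<^sup>2" by simp
    then have "- K\<^sup>2 \<le> \<alpha> * (\<alpha> * (norm v)\<^sup>2 - 2 * (norm v * K))"
      by (simp add: power2_eq_square algebra_simps)
    also have "\<dots> \<le> \<alpha> * J v"
      using K[of v] coercive[of v] \<alpha> unfolding J_def by (intro mult_left_mono) auto
    finally show ?thesis using \<alpha> by (simp add: field_simps)
  qed
  define m where "m = Inf (range J)"
  have bdd: "bdd_below (range J)" using lower by (intro bdd_belowI[of _ "- K\<^sup>2 / \<alpha>"]) auto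
  have m_le: "m \<le> J v" for v unfolding m_def using bdd by (simp add: cInf_lower)
  have "\<exists>x. J x < m + inverse (real (Suc n))" for n
    using cInf_lessD[of "range J" "m + inverse (real (Suc n))"] by (auto simp: m_def)
  then obtain X where X: "\<And>n. J (X n) < m + inverse (real (Suc n))" by metis
  have close: "\<alpha> * (norm (x - y))\<^sup>2 \<le> 2 * (J x - m) + 2 * (J y - m)" for x y
  proof -
    define z where "z = (1/2) *\<^sub>R (x + y)"
    have "2 * J x + 2 * J y = 4 * J z + a (x - y) (x - y)"
      unfolding J_def z_def using sym[of x y]
      by (simp add: a.add_left a.add_right a.diff_left a.diff_right a.scaleR_left a.scaleR_right
          L.add L.scaleR field_simps)
    then show ?thesis using m_le[of z] coercive[of "x - y"] unfolding right_diff_distrib by linarith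
  qed
  have "Cauchy X"
  proof (rule CauchyI)
    fix e :: real assume e: "e > 0"
    then have "\<alpha> * e\<^sup>2 / 4 > 0" using \<alpha> by simp
    then obtain N where N: "N > 0" "inverse (real N) < \<alpha> * e\<^sup>2 / 4"
      using ex_inverse_of_nat_less by blast
    have small: "J (X n) - m < \<alpha> * e\<^sup>2 / 4" if "n \<ge> N" for n
    proof -
      have "inverse (real (Suc n)) \<le> inverse (real N)" using that N by (simp add: field_simps)
      then show ?thesis using X[of n] N by linarith
    qed
    have "norm (X p - X q) < e" if "p \<ge> N" "q \<ge> N" for p q
    proof -
      have "\<alpha> * (norm (X p - X q))\<^sup>2 < 4 * (\<alpha> * e\<^sup>2 / 4)"
        using close[of "X p" "X q"] small[OF that(1)] small[OF that(2)]
        unfolding right_diff_distrib by linarith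
      then have "(norm (X p - X q))\<^sup>2 < e\<^sup>2" using \<alpha> by simp
      then show ?thesis by (rule power_less_imp_less_base) (use e in auto)
    qed
    then show "\<exists>M. \<forall>m\<ge>M. \<forall>n\<ge>M. norm (X m - X n) < e" by blast
  qed
  then obtain x where x: "X \<longlonglongrightarrow> x" using Cauchy_convergent_iff convergent_def by blast
  have "(\<lambda>n. J (X n)) \<longlonglongrightarrow> J x" unfolding J_def
    by (intro tendsto_intros a.tendsto L.tendsto x)
  moreover have "(\<lambda>n. m + inverse (real (Suc n))) \<longlonglongrightarrow> m"
    using tendsto_add[OF tendsto_const LIMSEQ_inverse_real_of_nat, of m] by simp
  ultimately have "J x \<le> m" using X by (intro LIMSEQ_le) (auto intro: less_imp_le)
  then have x_min: "J x \<le> J v" for v using m_le[of v] by linarith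
  have "a x v = L v" for v
  proof -
    define c where "c = a x v - L v"
    define k where "k = a v v + 1"
    have k: "k > 0" using coercive[of v] \<alpha> zero_le_power2[of "norm v"]
      unfolding k_def by (smt (verit) mult_nonneg_nonneg)
    \<comment> \<open>a step from \<open>x\<close> against the derivative \<open>2 c\<close> of the energy in direction \<open>v\<close>; the \<open>+ 1\<close> in
      \<open>k\<close> makes the step short enough that a nonzero \<open>c\<close> would decrease the energy\<close>
    define t where "t = - c / k"
    have "J (x + t *\<^sub>R v) = J x + t\<^sup>2 * a v v + 2 * t * c"
      unfolding J_def c_def using sym[of x v]
      by (simp add: a.add_left a.add_right a.scaleR_left a.scaleR_right L.add L.scaleR
          power2_eq_square algebra_simps)
    then have "0 \<le> t\<^sup>2 * (k - 1) + 2 * t * c" using x_min[of "x + t *\<^sub>R v"] by (simp add: k_def)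
    also have "\<dots> = - (c\<^sup>2 / k) - (c / k)\<^sup>2"
      using k unfolding t_def by (simp add: field_simps power2_eq_square)
    finally have "(c / k)\<^sup>2 \<le> - (c\<^sup>2 / k)" by simp
    moreover have "0 \<le> c\<^sup>2 / k" using k by simp
    ultimately have "(c / k)\<^sup>2 \<le> 0" by linarith
    then show ?thesis using k by (simp add: c_def)
  qed
  then show ?thesis by blast
qed

lemma form_operator_inner:
  fixes b :: "'v::{real_inner, complete_space} \<Rightarrow> 'm::{real_inner, complete_space} \<Rightarrow> real"
  assumes "bounded_bilinear b"
  shows "form_operator b u \<bullet> \<mu> = b u \<mu>"
proof -
  have "\<exists>w. \<forall>\<mu>. w \<bullet> \<mu> = b u \<mu>"
    using bounded_bilinear_inner inner_commute _ _ bounded_bilinear.bounded_linear_right[OF assms]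
    by (rule symmetric_lax_milgram[where \<alpha> = 1]) (auto simp: power2_norm_eq_inner)
  then have "\<exists>!w. \<forall>\<mu>. w \<bullet> \<mu> = b u \<mu>" by (metis vector_eq_rdot)
  from theI'[OF this] show ?thesis by (simp add: form_operator_def)
qed

lemma bounded_linear_form_operator:
  fixes b :: "'v::{real_inner, complete_space} \<Rightarrow> 'm::{real_inner, complete_space} \<Rightarrow> real"
  assumes b: "bounded_bilinear b"
  shows "bounded_linear (form_operator b)"
proof -
  interpret b: bounded_bilinear b by (fact b)
  obtain K where K: "K > 0" "\<And>x y. norm (b x y) \<le> norm x * norm y * K"
    using b.pos_bounded by blast
  show ?thesis
  proof (rule bounded_linear_intro)
    show "form_operator b (x + y) = form_operator b x + form_operator b y" for x y
      by (subst vector_eq_rdot[symmetric])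
        (simp add: form_operator_inner[OF b] inner_add_left b.add_left)
    show "form_operator b (r *\<^sub>R x) = r *\<^sub>R form_operator b x" for r x
      by (subst vector_eq_rdot[symmetric]) (simp add: form_operator_inner[OF b] b.scaleR_left)
    show "norm (form_operator b x) \<le> norm x * K" for x
    proof -
      let ?w = "form_operator b x"
      have "norm ?w * norm ?w = b x ?w"
        by (simp add: form_operator_inner[OF b, symmetric] norm_eq_sqrt_inner)
      also have "\<dots> \<le> norm x * K * norm ?w" using K(2)[of x ?w] by (simp add: algebra_simps)
      finally show ?thesis using K(1) by (cases "?w = 0") auto
    qed
  qed
qed

section \<open>Tikhonov regularization\<close>

lemma tikhonov_solution_exists:
  fixes A :: "'v::{real_inner, complete_space} \<Rightarrow> 'h::real_inner"
  assumes A: "bounded_linear A" and \<epsilon>: "\<epsilon> > 0"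
  shows "\<exists>u. \<forall>v. \<epsilon> * (u \<bullet> v) + A u \<bullet> A v = g \<bullet> A v"
proof (rule symmetric_lax_milgram[OF _ _ \<epsilon>])
  interpret A: bounded_linear A by (fact A)
  have "bounded_linear (\<lambda>x. (\<epsilon> *\<^sub>R x, A x))"
    by (intro bounded_linear_Pair bounded_linear_scaleR_right A)
  moreover have "bounded_linear (\<lambda>x. (x, A x))"
    by (intro bounded_linear_Pair bounded_linear_ident A)
  ultimately have "bounded_bilinear (\<lambda>x y. (\<epsilon> *\<^sub>R x, A x) \<bullet> (y, A y))"
    by (rule bounded_bilinear.comp[OF bounded_bilinear_inner])
  then show "bounded_bilinear (\<lambda>x y. \<epsilon> * (x \<bullet> y) + A x \<bullet> A y)" by simp
  show "bounded_linear (\<lambda>v. g \<bullet> A v)"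
    by (rule bounded_linear_compose[OF bounded_linear_inner_right A])
qed (auto simp: inner_commute power2_norm_eq_inner)

locale tikhonov_path =
  fixes A :: "'v::real_inner \<Rightarrow> 'h::{real_inner, complete_space}"
    and g :: 'h and u :: "real \<Rightarrow> 'v"
  assumes A: "bounded_linear A"
    and normal_eq: "\<And>\<epsilon> v. \<epsilon> > 0 \<Longrightarrow> \<epsilon> * (u \<epsilon> \<bullet> v) + A (u \<epsilon>) \<bullet> A v = g \<bullet> A v"
begin

sublocale A: bounded_linear A by (fact A)

definition residual :: "real \<Rightarrow> 'h" where
  "residual \<epsilon> = g - A (u \<epsilon>)"

lemma residual_inner: "\<epsilon> > 0 \<Longrightarrow> residual \<epsilon> \<bullet> A v = \<epsilon> * (u \<epsilon> \<bullet> v)"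
  using normal_eq[of \<epsilon> v] by (simp add: residual_def inner_diff_left)

text \<open>The difference of the normal equations for \<open>\<epsilon>\<close> and \<open>\<eta>\<close>, tested with \<open>u \<epsilon> - u \<eta>\<close>.
  With the roles exchanged, it bounds the increment of \<open>u\<close> around a fixed parameter.\<close>

lemma parameter_change:
  assumes "\<epsilon> > 0" "\<eta> > 0"
  shows "\<eta> * (norm (u \<epsilon> - u \<eta>))\<^sup>2 + (norm (A (u \<epsilon> - u \<eta>)))\<^sup>2 = (\<eta> - \<epsilon>) * (u \<epsilon> \<bullet> (u \<epsilon> - u \<eta>))"
proof -
  define d where "d = u \<epsilon> - u \<eta>"
  have "(norm (A d))\<^sup>2 = (residual \<eta> - residual \<epsilon>) \<bullet> A d"
    by (simp add: power2_norm_eq_inner residual_def d_def A.diff)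
  also have "\<dots> = \<eta> * ((u \<epsilon> - d) \<bullet> d) - \<epsilon> * (u \<epsilon> \<bullet> d)"
    using assms by (simp add: inner_diff_left[of "residual \<eta>"] residual_inner d_def)
  finally show ?thesis
    by (simp add: d_def[symmetric] power2_norm_eq_inner inner_diff_left algebra_simps)
qed

lemma solution_increment_bound:
  assumes "\<epsilon> > 0" "\<eta> > 0"
  shows "norm (u \<epsilon> - u \<eta>) \<le> \<bar>\<epsilon> - \<eta>\<bar> / \<epsilon> * norm (u \<eta>)"
proof -
  let ?d = "u \<eta> - u \<epsilon>"
  have "\<epsilon> * (norm ?d)\<^sup>2 \<le> (\<epsilon> - \<eta>) * (u \<eta> \<bullet> ?d)"
    using parameter_change[OF assms(2,1)] zero_le_power2[of "norm (A ?d)"] by linarith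
  also have "\<dots> \<le> \<bar>\<epsilon> - \<eta>\<bar> * (norm (u \<eta>) * norm ?d)"
    by (rule order_trans[OF abs_ge_self])
      (simp add: abs_mult mult_left_mono Cauchy_Schwarz_ineq2)
  finally have "(\<epsilon> * norm ?d) * norm ?d \<le> (\<bar>\<epsilon> - \<eta>\<bar> * norm (u \<eta>)) * norm ?d"
    by (simp add: power2_eq_square mult.assoc)
  then have "\<epsilon> * norm ?d \<le> \<bar>\<epsilon> - \<eta>\<bar> * norm (u \<eta>)" by (cases "?d = 0") auto
  then show ?thesis using assms by (simp add: field_simps norm_minus_commute)
qed

lemma continuous_on_residual: "continuous_on {0<..} residual"
proof -
  have "(u \<longlongrightarrow> u \<eta>) (at \<eta> within {0<..})" if "\<eta> > 0" for \<eta>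
  proof (rule LIM_zero_cancel, rule tendsto_rabs_zero_cancel[THEN tendsto_norm_zero_cancel])
    show "((\<lambda>\<epsilon>. \<bar>norm (u \<epsilon> - u \<eta>)\<bar>) \<longlongrightarrow> 0) (at \<eta> within {0<..})"
    proof (rule tendsto_sandwich[OF _ _ tendsto_const])
      have "((\<lambda>\<epsilon>. \<bar>\<epsilon> - \<eta>\<bar> / \<epsilon> * norm (u \<eta>)) \<longlongrightarrow> \<bar>\<eta> - \<eta>\<bar> / \<eta> * norm (u \<eta>)) (at \<eta> within {0<..})"
        using that by (intro tendsto_intros) auto
      then show "((\<lambda>\<epsilon>. \<bar>\<epsilon> - \<eta>\<bar> / \<epsilon> * norm (u \<eta>)) \<longlongrightarrow> 0) (at \<eta> within {0<..})" by simp
      show "\<forall>\<^sub>F \<epsilon> in at \<eta> within {0<..}. \<bar>norm (u \<epsilon> - u \<eta>)\<bar> \<le> \<bar>\<epsilon> - \<eta>\<bar> / \<epsilon> * norm (u \<eta>)"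
        using that unfolding eventually_at_filter
        by (intro always_eventually) (auto intro: solution_increment_bound simp del: times_divide_eq_left)
    qed auto
  qed
  then have "continuous_on {0<..} u" by (auto simp: continuous_on_def)
  then show ?thesis unfolding residual_def by (intro continuous_intros A.continuous_on)
qed

text \<open>The residual increment \<open>A (u \<epsilon> - u \<eta>)\<close> need not be orthogonal to \<open>residual \<epsilon>\<close>, but by the normal
  equation their inner product is a multiple of \<open>u \<epsilon> \<bullet> (u \<epsilon> - u \<eta>)\<close>, which is nonnegative by
  \<open>parameter_change\<close>.\<close>

lemma residual_increment:
  assumes "0 < \<epsilon>" "\<epsilon> < \<eta>"
  shows "(norm (residual \<eta> - residual \<epsilon>))\<^sup>2 + 2 * \<epsilon> * (norm (u \<epsilon> - u \<eta>))\<^sup>2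
    \<le> (norm (residual \<eta>))\<^sup>2 - (norm (residual \<epsilon>))\<^sup>2"
proof -
  define d where "d = u \<epsilon> - u \<eta>"
  have diff: "residual \<eta> = residual \<epsilon> + A d"
    by (simp add: residual_def d_def A.diff)
  have "(\<eta> - \<epsilon>) * (norm d)\<^sup>2 \<le> \<eta> * (norm d)\<^sup>2" using assms by (intro mult_right_mono) auto
  also have "\<dots> \<le> (\<eta> - \<epsilon>) * (u \<epsilon> \<bullet> d)"
    using parameter_change[of \<epsilon> \<eta>] assms zero_le_power2[of "norm (A d)"] unfolding d_def by linarith
  finally have "(norm d)\<^sup>2 \<le> u \<epsilon> \<bullet> d" using assms by simp
  then have "\<epsilon> * (norm d)\<^sup>2 \<le> residual \<epsilon> \<bullet> A d" using assms by (simp add: residual_inner)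
  moreover have "(norm (residual \<eta>))\<^sup>2 =
      (norm (residual \<epsilon>))\<^sup>2 + 2 * (residual \<epsilon> \<bullet> A d) + (norm (A d))\<^sup>2"
    unfolding diff power2_norm_eq_inner by (simp add: inner_add_left inner_add_right inner_commute)
  ultimately show ?thesis by (simp add: diff d_def[symmetric])
qed

text \<open>The residual norms at \<open>\<epsilon> < \<eta>\<close> can only agree if \<open>u \<epsilon> = u \<eta>\<close>. Then both normal equations force
  this common solution to vanish, which needs \<open>g\<close> orthogonal to the range of \<open>A\<close>.\<close>

lemma residual_strict_mono:
  assumes "0 < \<epsilon>" "\<epsilon> < \<eta>" and g: "\<not> (\<forall>v. g \<bullet> A v = 0)"
  shows "(norm (residual \<epsilon>))\<^sup>2 < (norm (residual \<eta>))\<^sup>2"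
proof -
  have "u \<epsilon> \<noteq> u \<eta>"
  proof
    assume eq: "u \<epsilon> = u \<eta>"
    then have "\<epsilon> * (u \<epsilon> \<bullet> u \<epsilon>) = \<eta> * (u \<epsilon> \<bullet> u \<epsilon>)"
      using assms residual_inner[of \<epsilon> "u \<epsilon>"] residual_inner[of \<eta> "u \<epsilon>"] by (simp add: residual_def)
    then have "u \<epsilon> = 0" using assms by simp
    then show False using g normal_eq[OF assms(1)] by (simp add: A.zero)
  qed
  then have "0 < 2 * \<epsilon> * (norm (u \<epsilon> - u \<eta>))\<^sup>2" using assms by simp
  then show ?thesis
    using residual_increment[OF assms(1,2)] zero_le_power2[of "norm (residual \<eta> - residual \<epsilon>)"]
    by linarith
qed

lemma residual_eq_data:
  assumes "\<epsilon> > 0" and g: "\<forall>v. g \<bullet> A v = 0"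
  shows "residual \<epsilon> = g"
proof -
  have "\<epsilon> * (u \<epsilon> \<bullet> u \<epsilon>) + A (u \<epsilon>) \<bullet> A (u \<epsilon>) = 0" using normal_eq[OF assms(1)] g by simp
  moreover have "0 \<le> \<epsilon> * (u \<epsilon> \<bullet> u \<epsilon>)" using assms by simp
  ultimately have "A (u \<epsilon>) \<bullet> A (u \<epsilon>) = 0" using inner_ge_zero[of "A (u \<epsilon>)"] by linarith
  then show ?thesis by (simp add: residual_def)
qed

text \<open>Testing the normal equation with \<open>u \<epsilon>\<close> gives \<open>\<epsilon> \<parallel>u\<parallel>\<^sup>2 = (g, A u) - \<parallel>A u\<parallel>\<^sup>2\<close>. This controls \<open>u \<epsilon>\<close> at
  both ends: \<open>u \<epsilon>\<close> vanishes at infinity, and \<open>\<epsilon> u \<epsilon>\<close> vanishes at zero.\<close>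

lemma solution_energy_bound:
  assumes "\<epsilon> > 0"
  shows "\<epsilon> * (norm (u \<epsilon>))\<^sup>2 \<le> (norm g)\<^sup>2"
proof -
  have "\<epsilon> * (norm (u \<epsilon>))\<^sup>2 = g \<bullet> A (u \<epsilon>) - A (u \<epsilon>) \<bullet> A (u \<epsilon>)"
    using normal_eq[OF assms, of "u \<epsilon>"] by (simp add: power2_norm_eq_inner)
  also have "\<dots> \<le> g \<bullet> g"
    using inner_ge_zero[of "g - A (u \<epsilon>)"] inner_ge_zero[of g] inner_ge_zero[of "A (u \<epsilon>)"]
    unfolding inner_diff_left inner_diff_right inner_commute[of "A (u \<epsilon>)" g] by linarith
  finally show ?thesis by (simp add: power2_norm_eq_inner)
qed

lemma residual_tendsto_data: "(residual \<longlongrightarrow> g) at_top"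
proof -
  have "((\<lambda>\<epsilon>. norm g * sqrt (inverse \<epsilon>)) \<longlongrightarrow> norm g * sqrt 0) at_top"
    by (intro tendsto_intros tendsto_inverse_0_at_top filterlim_ident)
  moreover have "\<forall>\<^sub>F \<epsilon> in at_top. norm (u \<epsilon>) \<le> norm g * sqrt (inverse \<epsilon>)"
    using eventually_gt_at_top[of 0]
  proof eventually_elim
    case (elim \<epsilon>)
    then have "(norm (u \<epsilon>))\<^sup>2 \<le> (norm g)\<^sup>2 * inverse \<epsilon>"
      using solution_energy_bound[of \<epsilon>] by (simp add: field_simps)
    then have "(norm (u \<epsilon>))\<^sup>2 \<le> (norm g * sqrt (inverse \<epsilon>))\<^sup>2"
      using elim by (simp add: power_mult_distrib)
    then show ?case by (rule power2_le_imp_le) (use elim in auto)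
  qed
  ultimately have "((\<lambda>\<epsilon>. norm (u \<epsilon>)) \<longlongrightarrow> 0) at_top"
    by (intro Lim_null_comparison[of "\<lambda>\<epsilon>. norm (u \<epsilon>)"]) auto
  then have "((\<lambda>\<epsilon>. g - A (u \<epsilon>)) \<longlongrightarrow> g - A 0) at_top"
    by (intro tendsto_intros A.tendsto) (rule tendsto_norm_zero_cancel)
  then show ?thesis by (simp add: residual_def[abs_def] A.zero)
qed

text \<open>The limit of the residuals for vanishing parameter is the component of \<open>g\<close> orthogonal to the
  range of \<open>A\<close>. Convergence follows from \<open>residual_increment\<close> because the squared norms
  decrease and are bounded below.\<close>

lemma residual_tendsto_projection:
  obtains p where "(\<lambda>n. residual (inverse (real (Suc n)))) \<longlonglongrightarrow> p"
    and "\<And>v. p \<bullet> A v = 0" and "\<And>y. (\<forall>v. A v \<bullet> y = 0) \<Longrightarrow> (g - p) \<bullet> y = 0"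
proof -
  define \<epsilon> where "\<epsilon> n = inverse (real (Suc n))" for n
  define R where "R n = residual (\<epsilon> n)" for n
  have \<epsilon>_pos: "\<epsilon> n > 0" for n by (simp add: \<epsilon>_def)
  have \<epsilon>_lim: "\<epsilon> \<longlonglongrightarrow> 0" unfolding \<epsilon>_def by (rule LIMSEQ_inverse_real_of_nat)
  have step: "(norm (R m - R n))\<^sup>2 \<le> (norm (R m))\<^sup>2 - (norm (R n))\<^sup>2" if "m \<le> n" for m n
  proof (cases "m = n")
    case False
    then have "\<epsilon> n < \<epsilon> m" using that by (simp add: \<epsilon>_def)
    from residual_increment[OF \<epsilon>_pos this] show ?thesis
      using \<epsilon>_pos[of n] unfolding R_def
      by (smt (verit) mult_nonneg_nonneg zero_le_power2)
  qed simp
  have "decseq (\<lambda>n. (norm (R n))\<^sup>2)"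
    unfolding decseq_def
  proof (intro allI impI)
    show "(norm (R n))\<^sup>2 \<le> (norm (R m))\<^sup>2" if "m \<le> n" for m n
      using step[OF that] zero_le_power2[of "norm (R m - R n)"] by linarith
  qed
  then have conv: "Cauchy (\<lambda>n. (norm (R n))\<^sup>2)"
    by (metis LIMSEQ_imp_Cauchy decseq_convergent zero_le_power2)
  have "Cauchy R"
  proof (rule CauchyI)
    fix e :: real assume e: "e > 0"
    then obtain N where N: "\<And>m n. m \<ge> N \<Longrightarrow> n \<ge> N \<Longrightarrow> \<bar>(norm (R m))\<^sup>2 - (norm (R n))\<^sup>2\<bar> < e\<^sup>2"
      using CauchyD[OF conv, of "e\<^sup>2"] by auto
    have "norm (R m - R n) < e" if "m \<ge> N" "n \<ge> N" for m n
    proof -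
      have "(norm (R m - R n))\<^sup>2 \<le> \<bar>(norm (R m))\<^sup>2 - (norm (R n))\<^sup>2\<bar>"
        using step[of m n] step[of n m] by (cases "m \<le> n") (auto simp: norm_minus_commute)
      then have "(norm (R m - R n))\<^sup>2 < e\<^sup>2" using N[OF that] by linarith
      then show ?thesis by (rule power_less_imp_less_base) (use e in auto)
    qed
    then show "\<exists>M. \<forall>m\<ge>M. \<forall>n\<ge>M. norm (R m - R n) < e" by blast
  qed
  then obtain p where p: "R \<longlonglongrightarrow> p" using Cauchy_convergent_iff convergent_def by blast
  have "p \<bullet> A v = 0" for v
  proof -
    have "(\<lambda>n. norm g * sqrt (\<epsilon> n) * norm v) \<longlonglongrightarrow> norm g * sqrt 0 * norm v"
      by (intro tendsto_intros \<epsilon>_lim)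
    moreover have "norm (R n \<bullet> A v) \<le> norm g * sqrt (\<epsilon> n) * norm v" for n
    proof -
      have "(\<epsilon> n * norm (u (\<epsilon> n)))\<^sup>2 = \<epsilon> n * (\<epsilon> n * (norm (u (\<epsilon> n)))\<^sup>2)"
        by (simp add: power2_eq_square)
      also have "\<dots> \<le> \<epsilon> n * (norm g)\<^sup>2"
        using solution_energy_bound[OF \<epsilon>_pos] \<epsilon>_pos[of n] by (intro mult_left_mono) auto
      also have "\<dots> = (norm g * sqrt (\<epsilon> n))\<^sup>2"
        using \<epsilon>_pos[of n] by (simp add: power_mult_distrib)
      finally have "\<epsilon> n * norm (u (\<epsilon> n)) \<le> norm g * sqrt (\<epsilon> n)"
        by (rule power2_le_imp_le) (use \<epsilon>_pos[of n] in auto)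
      then have "\<epsilon> n * norm (u (\<epsilon> n)) * norm v \<le> norm g * sqrt (\<epsilon> n) * norm v"
        by (simp add: mult_right_mono)
      moreover have "norm (R n \<bullet> A v) \<le> \<epsilon> n * norm (u (\<epsilon> n)) * norm v"
        using \<epsilon>_pos[of n] Cauchy_Schwarz_ineq2[of "u (\<epsilon> n)" v]
        by (simp add: R_def residual_inner abs_mult)
      ultimately show ?thesis by linarith
    qed
    ultimately have "(\<lambda>n. R n \<bullet> A v) \<longlonglongrightarrow> 0"
      by (intro Lim_null_comparison[of "\<lambda>n. R n \<bullet> A v"]) auto
    then show ?thesis using tendsto_inner[OF p tendsto_const] LIMSEQ_unique by blast
  qed
  moreover have "(g - p) \<bullet> y = 0" if y: "\<forall>v. A v \<bullet> y = 0" for y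
  proof -
    have "(\<lambda>n. (g - R n) \<bullet> y) \<longlonglongrightarrow> (g - p) \<bullet> y" by (intro tendsto_intros p)
    moreover have "(g - R n) \<bullet> y = 0" for n using y by (simp add: R_def residual_def)
    ultimately show ?thesis by (simp add: LIMSEQ_const_iff)
  qed
  ultimately show ?thesis using that p unfolding R_def \<epsilon>_def by blast
qed

lemma residual_tendsto_orthogonal_projection:
  "(\<lambda>n. residual (inverse (real (Suc n)))) \<longlonglongrightarrow>
    orthogonal_projection (orthogonal_comp (range A)) g"
proof -
  obtain p where p: "(\<lambda>n. residual (inverse (real (Suc n)))) \<longlonglongrightarrow> p" "\<And>v. p \<bullet> A v = 0"
    "\<And>y. (\<forall>v. A v \<bullet> y = 0) \<Longrightarrow> (g - p) \<bullet> y = 0"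
    by (rule residual_tendsto_projection) blast
  let ?S = "orthogonal_comp (range A)"
  have S: "y \<in> ?S \<longleftrightarrow> (\<forall>v. A v \<bullet> y = 0)" for y
    by (auto simp: orthogonal_comp_def orthogonal_def)
  have "orthogonal_projection ?S g = p" unfolding orthogonal_projection_def
  proof (rule the_equality)
    show "p \<in> ?S \<and> (\<forall>y\<in>?S. orthogonal (g - p) y)"
      using p(2,3) by (auto simp: S orthogonal_def inner_commute)
    fix q assume q: "q \<in> ?S \<and> (\<forall>y\<in>?S. orthogonal (g - q) y)"
    have pq: "\<forall>v. A v \<bullet> (q - p) = 0"
      using q p(2) by (simp add: S inner_diff_right inner_commute)
    then have "(g - q) \<bullet> (q - p) = 0" using q by (simp add: S orthogonal_def)
    with p(3)[OF pq] have "(q - p) \<bullet> (q - p) = 0" by (simp add: inner_diff_left)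
    then show "q = p" by simp
  qed
  with p(1) show ?thesis by simp
qed

theorem discrepancy_principle:
  assumes lower: "(norm (orthogonal_projection (orthogonal_comp (range A)) g))\<^sup>2 < \<Delta>"
    and upper: "\<Delta> < (norm g)\<^sup>2"
  shows "\<exists>!\<epsilon>. \<epsilon> > 0 \<and> (norm (residual \<epsilon>))\<^sup>2 = \<Delta>"
proof -
  define \<phi> where "\<phi> \<epsilon> = (norm (residual \<epsilon>))\<^sup>2" for \<epsilon>
  have "\<forall>\<^sub>F n in sequentially. \<phi> (inverse (real (Suc n))) < \<Delta>"
    unfolding \<phi>_def
    using order_tendstoD(2)[OF tendsto_power[OF tendsto_norm[OF residual_tendsto_orthogonal_projection]] lower] .
  then obtain n where n: "\<phi> (inverse (real (Suc n))) < \<Delta>"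
    using eventually_happens'[OF sequentially_bot] by blast
  define \<epsilon>\<^sub>0 where "\<epsilon>\<^sub>0 = inverse (real (Suc n))"
  have \<epsilon>\<^sub>0: "\<epsilon>\<^sub>0 > 0" "\<phi> \<epsilon>\<^sub>0 < \<Delta>" using n by (auto simp: \<epsilon>\<^sub>0_def)
  have "\<forall>\<^sub>F \<epsilon> in at_top. \<Delta> < \<phi> \<epsilon>"
    unfolding \<phi>_def
    using order_tendstoD(1)[OF tendsto_power[OF tendsto_norm[OF residual_tendsto_data]] upper] .
  then have "\<forall>\<^sub>F \<epsilon> in at_top. \<Delta> < \<phi> \<epsilon> \<and> \<epsilon>\<^sub>0 \<le> \<epsilon>"
    using eventually_ge_at_top by (rule eventually_conj)
  then obtain \<epsilon>\<^sub>1 where \<epsilon>\<^sub>1: "\<Delta> < \<phi> \<epsilon>\<^sub>1" "\<epsilon>\<^sub>0 \<le> \<epsilon>\<^sub>1"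
    using eventually_happens'[OF trivial_limit_at_top_linorder] by blast
  have "continuous_on {\<epsilon>\<^sub>0..\<epsilon>\<^sub>1} \<phi>"
    using \<epsilon>\<^sub>0 unfolding \<phi>_def
    by (intro continuous_intros continuous_on_subset[OF continuous_on_residual]) auto
  then obtain \<epsilon> where \<epsilon>: "\<epsilon> \<ge> \<epsilon>\<^sub>0" "\<phi> \<epsilon> = \<Delta>"
    using IVT'[of \<phi> \<epsilon>\<^sub>0 \<Delta> \<epsilon>\<^sub>1] \<epsilon>\<^sub>0 \<epsilon>\<^sub>1 by auto
  have "residual \<epsilon>\<^sub>0 \<noteq> g" using \<epsilon>\<^sub>0(2) upper by (auto simp: \<phi>_def)
  then have "\<not> (\<forall>v. g \<bullet> A v = 0)" using residual_eq_data[OF \<epsilon>\<^sub>0(1)] by blast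
  then have "\<phi> x < \<phi> y" if "0 < x" "x < y" for x y
    using residual_strict_mono that by (simp add: \<phi>_def)
  then have "x = y" if "x > 0" "y > 0" "\<phi> x = \<phi> y" for x y
    using that by (metis less_irrefl linorder_neqE_linordered_idom)
  then have "\<exists>!\<epsilon>. \<epsilon> > 0 \<and> \<phi> \<epsilon> = \<Delta>" using \<epsilon> \<epsilon>\<^sub>0 by (metis less_le_trans)
  then show ?thesis by (simp add: \<phi>_def)
qed

end

section \<open>The mixed formulation\<close>

text \<open>Eliminating \<open>l\<close> from the mixed problem leaves the normal equation for \<open>v \<mapsto> (B v, C v)\<close> and the
  data \<open>(0, f)\<close>.\<close>

lemma solves_mixed_iff:
  fixes b :: "'v::{real_inner, complete_space} \<Rightarrow> 'm::{real_inner, complete_space} \<Rightarrow> real"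
    and C :: "'v \<Rightarrow> 'o::{real_inner, complete_space}"
  assumes b: "bounded_bilinear b"
  defines "A \<equiv> \<lambda>v. (form_operator b v, C v)"
  shows "solves_mixed b C f \<epsilon> (u, l) \<longleftrightarrow>
    l = form_operator b u \<and> (\<forall>v. \<epsilon> * (u \<bullet> v) + A u \<bullet> A v = (0, f) \<bullet> A v)"
proof -
  have "(\<forall>\<mu>. b u \<mu> - l \<bullet> \<mu> = 0) \<longleftrightarrow> l = form_operator b u"
    by (auto simp: form_operator_inner[OF b, symmetric] vector_eq_rdot)
  moreover have "b v (form_operator b u) = form_operator b u \<bullet> form_operator b v" for v
    by (subst form_operator_inner[OF b, symmetric]) (rule inner_commute)
  moreover have "solves_mixed b C f \<epsilon> (u, l) \<longleftrightarrow>
      (\<forall>\<mu>. b u \<mu> - l \<bullet> \<mu> = 0) \<and> (\<forall>v. \<epsilon> * (u \<bullet> v) + C u \<bullet> C v + b v l = f \<bullet> C v)"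
    unfolding solves_mixed_def by blast
  ultimately show ?thesis by (simp add: A_def add_ac cong: conj_cong)
qed

text \<open>The reduced problem has a solution by minimization, and only one because the difference of two
  solutions has zero energy. Hence the definite description in \<open>mixed_solution\<close> denotes it.\<close>

lemma solves_mixed_solution:
  fixes b :: "'v::{real_inner, complete_space} \<Rightarrow> 'm::{real_inner, complete_space} \<Rightarrow> real"
    and C :: "'v \<Rightarrow> 'o::{real_inner, complete_space}"
  assumes b: "bounded_bilinear b" and C: "bounded_linear C" and \<epsilon>: "\<epsilon> > 0"
  shows "solves_mixed b C f \<epsilon> (mixed_solution b C f \<epsilon>)"
proof -
  define A where "A = (\<lambda>v. (form_operator b v, C v))"
  have A: "bounded_linear A"
    unfolding A_def by (rule bounded_linear_Pair[OF bounded_linear_form_operator[OF b] C])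
  interpret A: bounded_linear A by (fact A)
  have iff: "solves_mixed b C f \<epsilon> (w, k) \<longleftrightarrow>
      k = form_operator b w \<and> (\<forall>v. \<epsilon> * (w \<bullet> v) + A w \<bullet> A v = (0, f) \<bullet> A v)" for w k
    unfolding A_def by (rule solves_mixed_iff[OF b])
  obtain u where u: "\<And>v. \<epsilon> * (u \<bullet> v) + A u \<bullet> A v = (0, f) \<bullet> A v"
    using tikhonov_solution_exists[OF A \<epsilon>] by blast
  have "w = u" if w: "\<forall>v. \<epsilon> * (w \<bullet> v) + A w \<bullet> A v = (0, f) \<bullet> A v" for w
  proof -
    have "\<epsilon> * ((w - u) \<bullet> (w - u)) + A (w - u) \<bullet> A (w - u) = 0"
      using u[of "w - u"] w[rule_format, of "w - u"]
      by (simp add: A.diff[of w u] inner_diff_left[of w u] inner_diff_left[of "A w" "A u"]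
          right_diff_distrib)
    moreover have "0 \<le> A (w - u) \<bullet> A (w - u)" "0 \<le> (w - u) \<bullet> (w - u)"
      by (rule inner_ge_zero)+
    ultimately have "\<epsilon> * ((w - u) \<bullet> (w - u)) \<le> 0" by linarith
    then have "(w - u) \<bullet> (w - u) \<le> 0" using \<epsilon> by (simp add: mult_le_0_iff)
    then have "(w - u) \<bullet> (w - u) = 0" using inner_ge_zero[of "w - u"] by linarith
    then show ?thesis by simp
  qed
  then have "\<exists>!p. solves_mixed b C f \<epsilon> p"
    using u by (intro ex1I[of _ "(u, form_operator b u)"]) (auto simp: iff)
  then show ?thesis unfolding mixed_solution_def by (rule theI')
qed

theorem corollary3p1:
  fixes b :: "'v::{real_inner, complete_space} \<Rightarrow> 'm::{real_inner, complete_space} \<Rightarrow> real"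
    and B :: "'v \<Rightarrow> 'm"
    and C :: "'v \<Rightarrow> 'o::{real_inner, complete_space}"
    and A :: "'v \<Rightarrow> 'm \<times> 'o"
    and \<delta> :: real
    and f f_perp :: 'o
    and l_perp :: 'm
    and u :: "real \<Rightarrow> 'v"
    and l :: "real \<Rightarrow> 'm"
  assumes b: "bounded_bilinear b"
    and B: "B = form_operator b"
    and C: "bounded_linear C"
    and A: "A = (\<lambda>v. (B v, C v))"
    and inj: "inj A"
    and \<delta>: "\<delta> > 0"
    and perp: "(l_perp, f_perp) = orthogonal_projection (orthogonal_comp (range A)) (0, f)"
    and noise: "(norm l_perp)\<^sup>2 + (norm f_perp)\<^sup>2 < \<delta>\<^sup>2" "\<delta>\<^sup>2 < (norm f)\<^sup>2"
    and sol: "\<And>\<epsilon>. \<epsilon> > 0 \<Longrightarrow> (u \<epsilon>, l \<epsilon>) = mixed_solution b C f \<epsilon>"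
  shows "\<exists>!\<epsilon>. \<epsilon> > 0 \<and> (norm (l \<epsilon>))\<^sup>2 + (norm (C (u \<epsilon>) - f))\<^sup>2 = \<delta>\<^sup>2"
proof -
  have A_lin: "bounded_linear A"
    unfolding A B by (rule bounded_linear_Pair[OF bounded_linear_form_operator[OF b] C])
  have sol': "l \<epsilon> = B (u \<epsilon>) \<and> (\<forall>v. \<epsilon> * (u \<epsilon> \<bullet> v) + A (u \<epsilon>) \<bullet> A v = (0, f) \<bullet> A v)" if "\<epsilon> > 0" for \<epsilon>
  proof -
    have "solves_mixed b C f \<epsilon> (u \<epsilon>, l \<epsilon>)"
      unfolding sol[OF that] by (rule solves_mixed_solution[OF b C that])
    then show ?thesis unfolding solves_mixed_iff[OF b] A B .
  qed
  interpret T: tikhonov_path A "(0, f)" u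
    by (intro tikhonov_path.intro A_lin) (use sol' in blast)
  have norm_pair: "(norm (x, y))\<^sup>2 = (norm x)\<^sup>2 + (norm y)\<^sup>2" for x :: 'm and y :: 'o
    by (simp add: norm_Pair)
  have "(norm (orthogonal_projection (orthogonal_comp (range A)) (0, f)))\<^sup>2 < \<delta>\<^sup>2"
    using noise(1) unfolding perp[symmetric] norm_pair .
  moreover have "\<delta>\<^sup>2 < (norm (0 :: 'm, f))\<^sup>2"
    using noise(2) by (simp add: norm_pair)
  ultimately have "\<exists>!\<epsilon>. \<epsilon> > 0 \<and> (norm (T.residual \<epsilon>))\<^sup>2 = \<delta>\<^sup>2"
    by (rule T.discrepancy_principle)
  moreover have "(norm (T.residual \<epsilon>))\<^sup>2 = (norm (l \<epsilon>))\<^sup>2 + (norm (C (u \<epsilon>) - f))\<^sup>2" if "\<epsilon> > 0" for \<epsilon>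
  proof -
    have "T.residual \<epsilon> = (- l \<epsilon>, f - C (u \<epsilon>))"
      using sol'[OF that] unfolding T.residual_def by (simp add: A)
    then show ?thesis by (simp add: norm_pair norm_minus_commute)
  qed
  ultimately show ?thesis by (auto cong: conj_cong)
qed

end
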